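(* Let $|q|<1$ and let $k\geq 4$ be an integer. Then \[ \sum_{m_1,\dots,m_{k-2}\geq 0} \frac{q^{m_1^2+\cdots+m_{k-2}^2}}{(q)_{2m_1}} \Bigl(\prod_{j=2}^{k-3}\begin{bmatrix}m_{j-1}+m_j-m_{j+1}\\ 2m_j\end{bmatrix}\Bigr) \begin{bmatrix}m_{k-3}\\ m_{k-2}\end{bmatrix} =\frac{(q^{F_kF_{k-1}},q^{F_kF_{k-1}+1},q^{2F_kF_{k-1}+1};q^{2F_kF_{k-1}+1})_{\infty}}{(q;q)_{\infty}}. \]
   Context: $F_k$ denotes the Fibonacci numbers: $F_0=0$, $F_1=1$, $F_k=F_{k-1}+F_{k-2}$. $(x;q)_n=\prod_{i=0}^{n-1}(1-xq^i)$ (with $n=\infty$ allowed), $(q)_n=(q;q)_n$, and $(x_1,\dots,x_r;q)_\infty=\prod_{i=1}^r(x_i;q)_\infty$. The $q$-binomial coefficient is $\begin{bmatrix}n\\ m\end{bmatrix}=\frac{(q)_n}{(q)_m(q)_{n-m}}$ if $m$ and $n-m$ are nonnegative integers and $0$ otherwise. An empty product equals $1$. *)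

theory Defs
  imports "HOL-Analysis.Analysis" "HOL-Number_Theory.Fib"
begin

definition qpoch :: "complex \<Rightarrow> complex \<Rightarrow> nat \<Rightarrow> complex" where
  "qpoch x q n = (\<Prod>i<n. 1 - x * q ^ i)"

definition qpoch_inf :: "complex \<Rightarrow> complex \<Rightarrow> complex" where
  "qpoch_inf x q = (\<Prod>i. 1 - x * q ^ i)"

definition qbinom :: "complex \<Rightarrow> int \<Rightarrow> int \<Rightarrow> complex" where
  "qbinom q n m = (if 0 \<le> m \<and> m \<le> n
     then qpoch q q (nat n) / (qpoch q q (nat m) * qpoch q q (nat (n - m)))
     else 0)"

end

(*
  For nonnegative a, b put B(n, l; a, b) = [n + a - b, l - b] [n + b - a, l + b].  The Burge
  transform, a q-analogue of Nanjundiah's identity, states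
    sum_i q^(i^2) [n + l - i, 2 l] B(l, i; a, b) = q^(b^2) B(n, l; b, a + b),
  so each inner summation moves (a, b) one step along the Fibonacci recurrence.  The innermost
  binomial [n, l] is a signed theta-like combination of the B(n, l; t, t), hence after all the
  inner sums the parameters are t times consecutive Fibonacci numbers, and the accumulated
  exponent is t^2 (F_1^2 + ... + F_(k-1)^2) = t^2 F_k F_(k-1).  The outermost sum
  is evaluated by a finite form of Bailey's lemma; letting the cut-off tend to infinity leaves a
  theta series, to which the Jacobi triple product applies.
*)
theory Submission
  imports Defs
begin

subsection \<open>Gaussian binomials and the finite triple product\<close>

definition gbinom_nat :: "complex \<Rightarrow> nat \<Rightarrow> nat \<Rightarrow> complex" where
  "gbinom_nat q n k = qbinom q (int n) (int k)"

lemma qpoch_0 [simp]: "qpoch x q 0 = 1"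
  by (simp add: qpoch_def)

lemma qpoch_Suc: "qpoch x q (Suc n) = qpoch x q n * (1 - x * q ^ n)"
  by (simp add: qpoch_def)

lemma gbinom_nat_eq:
  "k \<le> n \<Longrightarrow> gbinom_nat q n k = qpoch q q n / (qpoch q q k * qpoch q q (n - k))"
  by (simp add: gbinom_nat_def qbinom_def flip: of_nat_diff)

lemma gbinom_nat_eq_0 [simp]: "n < k \<Longrightarrow> gbinom_nat q n k = 0"
  by (simp add: gbinom_nat_def qbinom_def)

lemma gbinom_nat_sym: "k \<le> n \<Longrightarrow> gbinom_nat q n (n - k) = gbinom_nat q n k"
  by (simp add: gbinom_nat_eq mult.commute)

lemma qbinom_nat_diff:
  "i \<le> n + l \<Longrightarrow> qbinom q (int n + int l - int i) (2 * int l) = gbinom_nat q (n + l - i) (2 * l)"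
  by (simp add: gbinom_nat_def)

text \<open>The terms of index \<open>t\<close> and \<open>-t\<close> of the bilateral triple product series, taken together:
  everything below is symmetric in the sign of the index, so sums can run over the naturals.\<close>

definition theta_coeff :: "complex \<Rightarrow> complex \<Rightarrow> nat \<Rightarrow> complex" where
  "theta_coeff x y t =
     (if t = 0 then 1 else (-1) ^ t * (x ^ t + y ^ t) * (x * y) ^ (t choose 2))"

lemma choose_two_add: "(j + t) choose 2 = (j choose 2) + (t choose 2) + j * t"
  by (induction j) (simp_all add: numeral_2_eq_2)

lemma twice_choose_two: "2 * (j choose 2) + j = j * j"
  by (induction j) (simp_all add: numeral_2_eq_2)

text \<open>Regroups a square by the difference of the two indices. Passing from \<open>n\<close> to
  \<open>Suc n\<close> adds the corner to the main diagonal and one symmetric pair to each diagonal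
  \<open>t\<close>, including the new one \<open>t = Suc n\<close>; these entries form the new
  border.\<close>

lemma sum_square_diagonals:
  fixes f :: "nat \<Rightarrow> nat \<Rightarrow> 'a::comm_monoid_add"
  shows "(\<Sum>i\<le>n. \<Sum>j\<le>n. f i j) =
    (\<Sum>j\<le>n. f j j) + (\<Sum>t=1..n. \<Sum>j\<le>n - t. f (j + t) j + f j (j + t))"
proof (induction n)
  case (Suc n)
  have *: "(\<Sum>t=1..Suc n. \<Sum>j\<le>Suc n - t. f (j + t) j + f j (j + t)) =
    (\<Sum>t=1..n. \<Sum>j\<le>n - t. f (j + t) j + f j (j + t)) + (\<Sum>j\<le>n. f (Suc n) j + f j (Suc n))"
  proof -
    have "(\<Sum>t=1..Suc n. \<Sum>j\<le>Suc n - t. f (j + t) j + f j (j + t)) =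
      (\<Sum>t=1..Suc n. (\<Sum>j<Suc n - t. f (j + t) j + f j (j + t))
         + (f (Suc n) (Suc n - t) + f (Suc n - t) (Suc n)))"
      by (intro sum.cong refl) (auto simp flip: lessThan_Suc_atMost)
    also have "\<dots> = (\<Sum>t=1..Suc n. \<Sum>j<Suc n - t. f (j + t) j + f j (j + t))
         + (\<Sum>t=1..Suc n. f (Suc n) (Suc n - t) + f (Suc n - t) (Suc n))"
      by (simp only: sum.distrib)
    also have "(\<Sum>t=1..Suc n. f (Suc n) (Suc n - t) + f (Suc n - t) (Suc n))
        = (\<Sum>j\<le>n. f (Suc n) j + f j (Suc n))"
      by (rule sum.reindex_bij_witness[of _ "\<lambda>j. Suc n - j" "\<lambda>t. Suc n - t"]) auto
    also have "(\<Sum>t=1..Suc n. \<Sum>j<Suc n - t. f (j + t) j + f j (j + t))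
        = (\<Sum>t=1..n. \<Sum>j<Suc n - t. f (j + t) j + f j (j + t))"
      by simp
    also have "\<dots> = (\<Sum>t=1..n. \<Sum>j\<le>n - t. f (j + t) j + f j (j + t))"
      by (intro sum.cong refl) (auto simp: Suc_diff_le simp flip: lessThan_Suc_atMost)
    finally show ?thesis .
  qed
  show ?case
    unfolding * using Suc by (simp add: sum.distrib algebra_simps)
qed simp

locale unit_disc =
  fixes q :: complex
  assumes norm_q: "norm q < 1"
begin

abbreviation gb where "gb \<equiv> gbinom_nat q"
abbreviation qp where "qp \<equiv> qpoch q q"

lemma one_minus_power_nonzero: "n > 0 \<Longrightarrow> 1 - q ^ n \<noteq> 0"
  using norm_q power_less_one_iff[of "norm q" n]
  by (metis norm_ge_zero norm_one norm_power order_less_irrefl right_minus_eq)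

lemma qp_nonzero [simp]: "qp n \<noteq> 0"
  using one_minus_power_nonzero[of "Suc _"] by (auto simp: qpoch_def)

lemma gb_0 [simp]: "gb n 0 = 1"
  by (simp add: gbinom_nat_eq)

lemma gb_self [simp]: "gb n n = 1"
  by (simp add: gbinom_nat_eq)

lemma gb_Suc_Suc: "gb (Suc n) (Suc k) = gb n k + q ^ Suc k * gb n (Suc k)"
proof (cases k n rule: linorder_cases)
  case less
  then obtain d where n: "n = Suc (k + d)"
    using less_imp_Suc_add by blast
  have nz: "1 - q * q ^ k \<noteq> 0" "1 - q * q ^ d \<noteq> 0"
    using one_minus_power_nonzero[of "Suc _"] by auto
  show ?thesis
    using nz unfolding n
    by (simp add: gbinom_nat_eq Suc_diff_le qpoch_Suc power_add divide_simps) (simp add: algebra_simps)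
qed auto

text \<open>Induction on \<open>x\<close>: the q-Pascal rule splits every
  \<open>gb (Suc x) j\<close>, and the two halves are instances of the claim with lower entries
  \<open>n - 1\<close> and \<open>n\<close>. The truncated \<open>x - j\<close> is harmless because
  \<open>gb x j\<close> vanishes for \<open>j > x\<close>.\<close>

lemma q_vandermonde:
  "gb (x + y) n = (\<Sum>j\<le>n. q ^ ((x - j) * (n - j)) * gb x j * gb y (n - j))"
proof (induction x arbitrary: n)
  case 0
  have "(\<Sum>j\<le>n. q ^ ((0 - j) * (n - j)) * gb 0 j * gb y (n - j)) = (\<Sum>j\<in>{0}. gb y (n - j))"
    by (rule sum.mono_neutral_cong_right) auto
  then show ?case by simp
next
  case (Suc x)
  show ?case
  proof (cases n)
    case (Suc m)
    have "(\<Sum>j\<le>n. q ^ ((Suc x - j) * (n - j)) * gb (Suc x) j * gb y (n - j)) =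
       q ^ (Suc x * n) * gb y n +
       (\<Sum>j\<le>m. q ^ ((x - j) * (m - j)) * gb x j * gb y (m - j)) +
       (\<Sum>j\<le>m. q ^ ((x - j) * (m - j) + Suc j) * gb x (Suc j) * gb y (m - j))"
      unfolding Suc by (subst sum.atMost_Suc_shift)
        (simp add: gb_Suc_Suc sum.distrib algebra_simps power_add)
    also have "(\<Sum>j\<le>m. q ^ ((x - j) * (m - j) + Suc j) * gb x (Suc j) * gb y (m - j)) =
       (\<Sum>j\<le>m. q ^ n * (q ^ ((x - Suc j) * (n - Suc j)) * gb x (Suc j) * gb y (n - Suc j)))"
    proof (intro sum.cong refl)
      fix j assume "j \<in> {..m}"
      then have j: "j \<le> m" by simp
      show "q ^ ((x - j) * (m - j) + Suc j) * gb x (Suc j) * gb y (m - j) =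
        q ^ n * (q ^ ((x - Suc j) * (n - Suc j)) * gb x (Suc j) * gb y (n - Suc j))"
      proof (cases "Suc j \<le> x")
        case True
        then have "x - j = Suc (x - Suc j)" by simp
        then have "(x - j) * (m - j) + Suc j = n + (x - Suc j) * (n - Suc j)"
          using j Suc by simp
        then show ?thesis by (simp add: power_add Suc)
      qed simp
    qed
    also have "q ^ (Suc x * n) * gb y n +
       (\<Sum>j\<le>m. q ^ ((x - j) * (m - j)) * gb x j * gb y (m - j)) + \<dots> =
       gb (x + y) m + q ^ n * gb (x + y) n"
      unfolding Suc.IH unfolding Suc
      by (subst sum.atMost_Suc_shift) (simp add: algebra_simps power_add sum_distrib_left)
    finally show ?thesis unfolding Suc by (simp add: gb_Suc_Suc)
  qed simp
qed

text \<open>Peeling off the first factor leaves \<open>qpoch (z * q) q n\<close>, hence the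
  induction keeps \<open>z\<close> arbitrary; the coefficients are then compared by the q-Pascal
  rule.\<close>

lemma q_binomial:
  "qpoch z q n = (\<Sum>j\<le>n. (-1) ^ j * q ^ (j choose 2) * gb n j * z ^ j)"
proof (induction n arbitrary: z)
  case (Suc n)
  \<comment> \<open>\<open>S\<close> is the expansion of \<open>qpoch (z * q) q n\<close> from the
    induction hypothesis. Its range can be extended to \<open>Suc n\<close> since
    \<open>gb n (Suc n)\<close> is zero.\<close>
  define S where "S = (\<Sum>j\<le>n. (-1) ^ j * q ^ (j choose 2) * q ^ j * gb n j * z ^ j)"
  have "S = (\<Sum>j\<le>Suc n. (-1) ^ j * q ^ (j choose 2) * q ^ j * gb n j * z ^ j)"
    by (simp add: S_def)
  also have "\<dots> = 1 +
     (\<Sum>j\<le>n. (-1) ^ Suc j * q ^ (Suc j choose 2) * q ^ Suc j * gb n (Suc j) * z ^ Suc j)"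
    by (subst sum.atMost_Suc_shift) (simp add: numeral_2_eq_2)
  finally have S: "S = \<dots>" .
  have c: "(Suc j choose 2) = (j choose 2) + j" for j
    by (simp add: numeral_2_eq_2)
  have step: "(-1) ^ Suc j * q ^ (Suc j choose 2) * q ^ Suc j * gb n (Suc j) * z ^ Suc j
      - z * ((-1) ^ j * q ^ (j choose 2) * q ^ j * gb n j * z ^ j)
    = (-1) ^ Suc j * q ^ (Suc j choose 2) * gb (Suc n) (Suc j) * z ^ Suc j" for j
    unfolding gb_Suc_Suc c power_add by (simp add: algebra_simps)
  have "qpoch z q (Suc n) = (1 - z) * qpoch (z * q) q n"
    unfolding qpoch_def by (subst prod.lessThan_Suc_shift) (simp add: mult_ac)
  also have "\<dots> = (1 - z) * S"
    unfolding Suc.IH S_def by (simp add: power_mult_distrib mult_ac)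
  also have "\<dots> = S - z * S"
    by (simp add: algebra_simps)
  also have "\<dots> = 1 + (\<Sum>j\<le>n. (-1) ^ Suc j * q ^ (Suc j choose 2) * gb (Suc n) (Suc j) * z ^ Suc j)"
    unfolding step[symmetric] sum_subtractf sum_distrib_left[symmetric] S_def[symmetric]
    using S by simp
  also have "\<dots> = (\<Sum>j\<le>Suc n. (-1) ^ j * q ^ (j choose 2) * gb (Suc n) j * z ^ j)"
    by (subst sum.atMost_Suc_shift) (simp add: numeral_2_eq_2)
  finally show ?case .
qed (simp add: numeral_2_eq_2)

text \<open>This is \<open>q_vandermonde\<close> for two blocks of size \<open>n\<close>, read
  through \<open>i = n - j\<close> and the symmetry of the Gaussian binomial.\<close>

lemma vandermonde_shift: "(\<Sum>j\<le>n - t. q ^ (j * (j + t)) * gb n (j + t) * gb n j) = gb (2 * n) (n + t)"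
  if "t \<le> n"
proof -
  have "gb (2 * n) (n + t) =
      (\<Sum>i\<le>n + t. q ^ ((n - i) * (n + t - i)) * gb n i * gb n (n + t - i))"
    using q_vandermonde[of n n "n + t"] by (simp add: mult_2)
  also have "\<dots> = (\<Sum>i\<in>{t..n}. q ^ ((n - i) * (n + t - i)) * gb n i * gb n (n + t - i))"
    by (rule sum.mono_neutral_right) (auto simp: not_le)
  also have "\<dots> = (\<Sum>j\<le>n - t. q ^ (j * (j + t)) * gb n (j + t) * gb n j)"
  proof (rule sum.reindex_bij_witness[of _ "\<lambda>j. n - j" "\<lambda>i. n - i"])
    fix i assume i: "i \<in> {t..n}"
    then have "gb n (n - i) = gb n i" "gb n (n - i + t) = gb n (n + t - i)"
      by (auto simp: gbinom_nat_sym)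
    then show "q ^ ((n - i) * (n - i + t)) * gb n (n - i + t) * gb n (n - i) =
        q ^ ((n - i) * (n + t - i)) * gb n i * gb n (n + t - i)"
      using i by (simp add: mult_ac)
  qed (use that in auto)
  finally show ?thesis ..
qed

text \<open>Both factors are expanded by \<open>q_binomial\<close>, and the double sum is grouped
  along the diagonals where the indices differ by \<open>t\<close>. Because
  \<open>x * y = q\<close>, the dependence on \<open>j\<close> along such a diagonal is exactly the
  summand of \<open>vandermonde_shift\<close>.\<close>

lemma finite_jacobi_triple_product:
  assumes xy: "x * y = q"
  shows "qpoch x q n * qpoch y q n = (\<Sum>t\<le>n. theta_coeff x y t * gb (2 * n) (n + t))"
proof -
  define f where "f = (\<lambda>i j. (-1) ^ i * q ^ (i choose 2) * gb n i * x ^ i *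
                        ((-1) ^ j * q ^ (j choose 2) * gb n j * y ^ j))"
  \<comment> \<open>With \<open>2 * (j choose 2) + j = j * j\<close>, all parts of the exponent that
    involve \<open>j\<close> collect to \<open>j * (j + t)\<close>.\<close>
  have ex: "2 * (j choose 2) + (t choose 2) + j * t + j = (t choose 2) + j * (j + t)" for j t
    using twice_choose_two[of j] by (simp add: algebra_simps)
  have "q ^ ((j + t) choose 2) * q ^ (j choose 2) * q ^ j = q ^ (t choose 2) * q ^ (j * (j + t))" for j t
    unfolding power_add[symmetric] choose_two_add ex[symmetric]
    by (rule arg_cong[where f = "power q"]) simp
  moreover have "x ^ j * y ^ j = q ^ j" for j
    by (simp add: xy flip: power_mult_distrib)
  ultimately have q1: "q ^ ((j + t) choose 2) * q ^ (j choose 2) * (x ^ j * y ^ j) =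
      q ^ (t choose 2) * q ^ (j * (j + t))" for j t
    by simp
  have f1: "f (j + t) j = (-1) ^ t * q ^ (t choose 2) * x ^ t * (q ^ (j * (j + t)) * gb n (j + t) * gb n j)" for j t
  proof -
    have "f (j + t) j = ((-1) ^ j * (-1) ^ j) * (-1) ^ t * x ^ t * gb n (j + t) * gb n j *
        (q ^ ((j + t) choose 2) * q ^ (j choose 2) * (x ^ j * y ^ j))"
      unfolding f_def power_add by (simp only: mult_ac)
    then show ?thesis unfolding q1 by (simp add: mult_ac flip: power_mult_distrib)
  qed
  have f2: "f j (j + t) = (-1) ^ t * q ^ (t choose 2) * y ^ t * (q ^ (j * (j + t)) * gb n (j + t) * gb n j)" for j t
  proof -
    have "f j (j + t) = ((-1) ^ j * (-1) ^ j) * (-1) ^ t * y ^ t * gb n (j + t) * gb n j *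
        (q ^ ((j + t) choose 2) * q ^ (j choose 2) * (x ^ j * y ^ j))"
      unfolding f_def power_add by (simp only: mult_ac)
    then show ?thesis unfolding q1 by (simp add: mult_ac flip: power_mult_distrib)
  qed
  have f0: "(\<Sum>j\<le>n. f j j) = gb (2 * n) n"
  proof -
    have "(\<Sum>j\<le>n. f j j) = (\<Sum>j\<le>n. f (j + 0) j)" by simp
    also have "\<dots> = (\<Sum>j\<le>n - 0. q ^ (j * (j + 0)) * gb n (j + 0) * gb n j)"
      unfolding f1 by (simp add: numeral_2_eq_2)
    finally show ?thesis by (subst (asm) vandermonde_shift) auto
  qed
  have "qpoch x q n * qpoch y q n = (\<Sum>i\<le>n. \<Sum>j\<le>n. f i j)"
    unfolding q_binomial f_def sum_product ..
  also have "\<dots> = gb (2 * n) n + (\<Sum>t=1..n. \<Sum>j\<le>n - t. f (j + t) j + f j (j + t))"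
    unfolding sum_square_diagonals f0 ..
  also have "(\<Sum>t=1..n. \<Sum>j\<le>n - t. f (j + t) j + f j (j + t)) =
      (\<Sum>t=1..n. theta_coeff x y t * gb (2 * n) (n + t))"
  proof (intro sum.cong refl)
    fix t assume t: "t \<in> {1..n}"
    have "(\<Sum>j\<le>n - t. f (j + t) j + f j (j + t)) = 
       (-1) ^ t * q ^ (t choose 2) * (x ^ t + y ^ t) *
       (\<Sum>j\<le>n - t. q ^ (j * (j + t)) * gb n (j + t) * gb n j)"
      unfolding f1 f2 sum_distrib_left by (intro sum.cong refl) (simp add: algebra_simps)
    with t show "(\<Sum>j\<le>n - t. f (j + t) j + f j (j + t)) = theta_coeff x y t * gb (2 * n) (n + t)"
      by (subst (asm) vandermonde_shift) (auto simp: theta_coeff_def xy mult_ac)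
  qed
  also have "gb (2 * n) n + \<dots> = (\<Sum>t\<le>n. theta_coeff x y t * gb (2 * n) (n + t))"
    by (simp add: sum.atLeast0_atMost_Suc_shift atMost_atLeast0 theta_coeff_def sum.atLeast_Suc_atMost[of 0])
  finally show ?thesis .
qed

section \<open>Finite Bailey summation and the theta expansion of a Gaussian binomial\<close>

text \<open>At \<open>x = q\<close>, \<open>y = 1\<close> the triple product contains
  \<open>qpoch 1 q r\<close>, whose first factor is zero as soon as \<open>r > 0\<close>.\<close>

lemma theta_sum_delta:
  "r \<le> l \<Longrightarrow> (\<Sum>t\<le>l. theta_coeff q 1 t * gb (2 * r) (r + t)) = (if r = 0 then 1 else 0)"
proof -
  assume r: "r \<le> l"
  have "(\<Sum>t\<le>l. theta_coeff q 1 t * gb (2 * r) (r + t)) =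
      (\<Sum>t\<le>r. theta_coeff q 1 t * gb (2 * r) (r + t))"
    by (rule sum.mono_neutral_right) (use r in auto)
  also have "\<dots> = qp r * qpoch 1 q r"
    by (subst finite_jacobi_triple_product) auto
  also have "qpoch 1 q r = (if r = 0 then 1 else 0)"
    by (auto simp: qpoch_def intro: bexI[of _ 0])
  finally show ?thesis by simp
qed

text \<open>For \<open>t <= r\<close> the quotient \<open>gb (2 * r) (r + t) / qp (2 * r)\<close> is
  the Bailey kernel \<open>1 / (qp (r - t) * qp (r + t))\<close>. Once the q-factorials are written
  out, the identity is \<open>q_vandermonde\<close> in the variable
  \<open>r = M - j\<close>.\<close>

lemma bailey_sum:
  "(\<Sum>r\<le>min L M. q ^ (r ^ 2) / (qp (L - r) * qp (M - r) * qp (2 * r)) * gb (2 * r) (r + t)) =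
     q ^ (t ^ 2) / qp (L + M) * gb (L + M) (L + t) * gb (L + M) (M + t)"
proof (cases "t \<le> min L M")
  case False
  then show ?thesis by (subst sum.neutral) (auto simp: min_def split: if_splits)
next
  case True
  then have t: "t \<le> L" "t \<le> M" by auto
  \<comment> \<open>Splitting the top entry as \<open>(M - t) + (L + t)\<close> makes the
    q-Vandermonde exponent equal to \<open>(r - t) * (r + t)\<close>, the difference of
    \<open>r ^ 2\<close> and \<open>t ^ 2\<close>.\<close>
  have "gb (L + M) (M + t) = gb ((M - t) + (L + t)) (M + t)"
    using t by (simp add: add.commute)
  also have "\<dots> = (\<Sum>j\<le>M + t. q ^ ((M - t - j) * (M + t - j)) * gb (M - t) j * gb (L + t) (M + t - j))"
    by (rule q_vandermonde)
  also have "\<dots> = (\<Sum>j\<in>{M - min L M..M - t}. q ^ ((M - t - j) * (M + t - j)) * gb (M - t) j * gb (L + t) (M + t - j))"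
    by (rule sum.mono_neutral_right) (use t in \<open>auto simp: not_le min_def split: if_splits\<close>)
  also have "\<dots> = (\<Sum>r\<in>{t..min L M}. q ^ ((r - t) * (r + t)) * gb (M - t) (M - r) * gb (L + t) (r + t))"
  proof (rule sum.reindex_bij_witness[of _ "\<lambda>r. M - r" "\<lambda>j. M - j"], goal_cases)
    case (5 a)
    then have "a \<le> M" "M - a - t = M - t - a" "M - a + t = M + t - a" by auto
    then show ?case by simp
  qed (use t in auto)
  finally have *: "gb (L + M) (M + t) = \<dots>" .
  have g: "gb (L + M) (L + t) = qp (L + M) / (qp (L + t) * qp (M - t))"
    using t by (simp add: gbinom_nat_eq)
  have "q ^ (t ^ 2) / qp (L + M) * gb (L + M) (L + t) * gb (L + M) (M + t) =
     (\<Sum>r\<in>{t..min L M}. q ^ (t ^ 2) / (qp (L + t) * qp (M - t)) *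
         (q ^ ((r - t) * (r + t)) * gb (M - t) (M - r) * gb (L + t) (r + t)))"
    unfolding * g sum_distrib_left by simp
  also have "\<dots> = (\<Sum>r\<in>{t..min L M}. q ^ (r ^ 2) / (qp (L - r) * qp (M - r) * qp (2 * r)) * gb (2 * r) (r + t))"
  proof (intro sum.cong refl)
    fix r assume r: "r \<in> {t..min L M}"
    then have "t ^ 2 + (r - t) * (r + t) = r ^ 2"
      by (auto simp: power2_eq_square nat_le_iff_add algebra_simps)
    then have e: "q ^ (r ^ 2) = q ^ (t ^ 2) * q ^ ((r - t) * (r + t))"
      by (metis power_add)
    have "gb (M - t) (M - r) = qp (M - t) / (qp (M - r) * qp (r - t))"
      "gb (L + t) (r + t) = qp (L + t) / (qp (r + t) * qp (L - r))"
      "gb (2 * r) (r + t) = qp (2 * r) / (qp (r + t) * qp (r - t))"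
      using r t by (auto simp: gbinom_nat_eq mult_2)
    then show "q ^ (t ^ 2) / (qp (L + t) * qp (M - t)) *
         (q ^ ((r - t) * (r + t)) * gb (M - t) (M - r) * gb (L + t) (r + t)) =
        q ^ (r ^ 2) / (qp (L - r) * qp (M - r) * qp (2 * r)) * gb (2 * r) (r + t)"
      unfolding e by simp
  qed
  also have "\<dots> = (\<Sum>r\<le>min L M. q ^ (r ^ 2) / (qp (L - r) * qp (M - r) * qp (2 * r)) * gb (2 * r) (r + t))"
    by (rule sum.mono_neutral_left) auto
  finally show ?thesis ..
qed

text \<open>Each product of binomials is expanded by \<open>bailey_sum\<close> with cut-offs
  \<open>l\<close> and \<open>n - l\<close>. After interchanging the sums,
  \<open>theta_sum_delta\<close> kills every \<open>r > 0\<close>, and the term \<open>r = 0\<close>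
  is the binomial itself.\<close>

lemma gb_theta_expansion:
  assumes "l \<le> n"
  shows "gb n l = (\<Sum>t\<le>l. theta_coeff q 1 t * q ^ (t ^ 2) * (gb n (l - t) * gb n (l + t)))"
proof -
  define M where "M = n - l"
  have n: "n = l + M" using assms by (simp add: M_def)
  define w where "w = (\<lambda>r. q ^ (r ^ 2) / (qp (l - r) * qp (M - r) * qp (2 * r)))"
  have "(\<Sum>t\<le>l. theta_coeff q 1 t * q ^ (t ^ 2) * (gb n (l - t) * gb n (l + t))) =
     (\<Sum>t\<le>l. qp n * theta_coeff q 1 t * (\<Sum>r\<le>min l M. w r * gb (2 * r) (r + t)))"
  proof (intro sum.cong refl)
    fix t assume "t \<in> {..l}"
    then have "gb n (l - t) = gb n (M + t)"
      using gbinom_nat_sym[of "l - t" n q] unfolding n by (simp add: Suc_diff_le)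
    then show "theta_coeff q 1 t * q ^ (t ^ 2) * (gb n (l - t) * gb n (l + t)) =
        qp n * theta_coeff q 1 t * (\<Sum>r\<le>min l M. w r * gb (2 * r) (r + t))"
      unfolding w_def bailey_sum n by simp
  qed
  also have "\<dots> = qp n * (\<Sum>r\<le>min l M. w r * (\<Sum>t\<le>l. theta_coeff q 1 t * gb (2 * r) (r + t)))"
    unfolding sum_distrib_left by (subst sum.swap) (simp add: mult_ac)
  also have "\<dots> = qp n * (\<Sum>r\<le>min l M. w r * (if r = 0 then 1 else 0))"
    by (subst sum.cong[OF refl]) (auto simp: theta_sum_delta)
  also have "\<dots> = gb n l"
    by (simp add: w_def n gbinom_nat_eq mult_ac if_distrib cong: if_cong)
  finally show ?thesis ..
qed

end

subsection \<open>The Burge transform\<close>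

text \<open>The \<open>d\<close> innermost sums of the multiple series, with the two preceding
  indices fixed at \<open>n\<close> and \<open>l\<close> and their own powers of \<open>q\<close>
  left out. Cutting at \<open>i <= l\<close> loses nothing, since \<open>nested_sum q d l i\<close>
  is zero for \<open>i > l\<close>.\<close>

primrec nested_sum :: "complex \<Rightarrow> nat \<Rightarrow> nat \<Rightarrow> nat \<Rightarrow> complex" where
  "nested_sum q 0 n l = gbinom_nat q n l"
| "nested_sum q (Suc d) n l =
     (\<Sum>i\<le>l. q ^ (i ^ 2) * qbinom q (int n + int l - int i) (2 * int l) * nested_sum q d l i)"

lemma nested_sum_eq_0: "n < l \<Longrightarrow> nested_sum q d n l = 0"
  by (cases d) (auto intro!: sum.neutral simp: qbinom_nat_diff)

context unit_disc
begin

lemma gb_mult_gb: "j \<le> k \<Longrightarrow> gb n k * gb k j = gb n j * gb (n - j) (k - j)"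
  by (cases "k \<le> n"; cases "j \<le> n") (auto simp: gbinom_nat_eq)

text \<open>Three uses of \<open>q_vandermonde\<close>: expand the last binomial in a new index
  \<open>j\<close>, sum over \<open>k\<close> first, then sum over \<open>j\<close>. The trinomial
  revision \<open>gb_mult_gb\<close> prepares the sum over \<open>k\<close> and afterwards extracts
  the constant factor \<open>gb (m + u) m\<close>.\<close>

lemma q_nanjundiah:
  assumes AB: "A + B = m + n"
  shows "(\<Sum>k\<le>n. q ^ ((A - k) * (n - k)) * gb A k * gb B (n - k) * gb (m + u + k) (m + n)) =
         gb (m + u) m * gb (A + u) n"
proof -
  have 1: "gb (m + u + k) (m + n) =
     (\<Sum>j\<le>n. q ^ ((u - (n - j)) * j) * gb (m + u) (m + (n - j)) * gb k j)" if k: "k \<le> n" for k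
  proof -
    have "gb (m + u + k) (m + n) = (\<Sum>i\<le>m + n. q ^ ((m + u - i) * (m + n - i)) * gb (m + u) i * gb k (m + n - i))"
      by (rule q_vandermonde)
    also have "\<dots> = (\<Sum>i\<in>{m..m + n}. q ^ ((m + u - i) * (m + n - i)) * gb (m + u) i * gb k (m + n - i))"
      by (rule sum.mono_neutral_right) (use k in \<open>auto simp: not_le\<close>)
    also have "\<dots> = (\<Sum>j\<le>n. q ^ ((u - (n - j)) * j) * gb (m + u) (m + (n - j)) * gb k j)"
      by (rule sum.reindex_bij_witness[of _ "\<lambda>j. m + (n - j)" "\<lambda>i. m + n - i"])
         (auto simp: mult.commute add.commute)
    finally show ?thesis .
  qed
  have 2: "(\<Sum>k\<le>n. q ^ ((A - k) * (n - k)) * gb A k * gb B (n - k) * gb k j) =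
      gb A j * gb (m + (n - j)) (n - j)" if j: "j \<le> n" for j
  proof (cases "j \<le> A")
    case True
    have "(\<Sum>k\<le>n. q ^ ((A - k) * (n - k)) * gb A k * gb B (n - k) * gb k j) =
       (\<Sum>k\<in>{j..n}. q ^ ((A - k) * (n - k)) * gb B (n - k) * (gb A k * gb k j))"
      by (rule sum.mono_neutral_cong_right) (auto simp: mult_ac)
    also have "\<dots> = gb A j * (\<Sum>k\<in>{j..n}. q ^ ((A - k) * (n - k)) * gb (A - j) (k - j) * gb B (n - k))"
      unfolding sum_distrib_left by (intro sum.cong refl, subst gb_mult_gb) (simp_all add: mult_ac)
    also have "(\<Sum>k\<in>{j..n}. q ^ ((A - k) * (n - k)) * gb (A - j) (k - j) * gb B (n - k)) =
       (\<Sum>i\<le>n - j. q ^ ((A - j - i) * (n - j - i)) * gb (A - j) i * gb B (n - j - i))"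
      by (rule sum.reindex_bij_witness[of _ "\<lambda>i. j + i" "\<lambda>k. k - j"]) (use j in auto)
    also have "\<dots> = gb (A - j + B) (n - j)"
      by (rule q_vandermonde[symmetric])
    also have "A - j + B = m + (n - j)"
      using AB True j by simp
    finally show ?thesis .
  next
    \<comment> \<open>No \<open>k\<close> satisfies \<open>j <= k <= A\<close>, so every term on the
      left vanishes together with \<open>gb A j\<close>.\<close>
    case False
    have "gb A k * gb k j = 0" for k
      using False by (cases "k < j"; cases "A < k") auto
    then have "(\<Sum>k\<le>n. q ^ ((A - k) * (n - k)) * gb A k * gb B (n - k) * gb k j) = 0"
      by (intro sum.neutral) auto
    with False show ?thesis by simp
  qed
  have 3: "gb (m + u) (m + (n - j)) * gb (m + (n - j)) (n - j) = gb (m + u) m * gb u (n - j)" for j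
    using gb_mult_gb[of m "m + (n - j)" "m + u"] gbinom_nat_sym[of m "m + (n - j)" q] by simp
  have 4: "(\<Sum>j\<le>n. q ^ ((u - (n - j)) * j) * gb A j * gb u (n - j)) = gb (A + u) n"
  proof -
    have "gb (A + u) n = gb (u + A) n" by (simp add: add.commute)
    also have "\<dots> = (\<Sum>i\<le>n. q ^ ((u - i) * (n - i)) * gb u i * gb A (n - i))"
      by (rule q_vandermonde)
    also have "\<dots> = (\<Sum>j\<le>n. q ^ ((u - (n - j)) * j) * gb A j * gb u (n - j))"
      by (rule sum.reindex_bij_witness[of _ "\<lambda>j. n - j" "\<lambda>i. n - i"]) auto
    finally show ?thesis ..
  qed
  have "(\<Sum>k\<le>n. q ^ ((A - k) * (n - k)) * gb A k * gb B (n - k) * gb (m + u + k) (m + n)) =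
     (\<Sum>k\<le>n. \<Sum>j\<le>n. q ^ ((u - (n - j)) * j) * gb (m + u) (m + (n - j)) *
         (q ^ ((A - k) * (n - k)) * gb A k * gb B (n - k) * gb k j))"
    by (intro sum.cong refl) (simp add: 1 sum_distrib_left mult_ac)
  also have "\<dots> = (\<Sum>j\<le>n. \<Sum>k\<le>n. q ^ ((u - (n - j)) * j) * gb (m + u) (m + (n - j)) *
         (q ^ ((A - k) * (n - k)) * gb A k * gb B (n - k) * gb k j))"
    by (rule sum.swap)
  also have "\<dots> = (\<Sum>j\<le>n. q ^ ((u - (n - j)) * j) * gb A j *
         (gb (m + u) (m + (n - j)) * gb (m + (n - j)) (n - j)))"
    by (intro sum.cong refl, subst sum_distrib_left[symmetric], subst 2) (simp_all add: mult_ac)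
  also have "\<dots> = gb (m + u) m * (\<Sum>j\<le>n. q ^ ((u - (n - j)) * j) * gb A j * gb u (n - j))"
    unfolding 3 sum_distrib_left by (simp add: mult_ac)
  finally show ?thesis unfolding 4 .
qed

text \<open>For \<open>a, b \<ge> 0\<close> the guard holds exactly when both integer binomials are nonzero; it
  protects against truncated subtraction.\<close>

definition burge_product :: "nat \<Rightarrow> nat \<Rightarrow> nat \<Rightarrow> nat \<Rightarrow> complex" where
  "burge_product n l a b =
     (if b \<le> l \<and> a + l \<le> n then gb (n + a - b) (l - b) * gb (n + b - a) (l + b) else 0)"

text \<open>The substitution \<open>k = L + a - i\<close> turns the weight
  \<open>q ^ (i ^ 2)\<close> into a q-Vandermonde weight times \<open>q ^ (b ^ 2)\<close>. The free
  factor \<open>g\<close> serves both the Burge transform and its limiting case.\<close>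

lemma sum_burge_product:
  assumes ab: "a + b \<le> L"
  shows "(\<Sum>i\<le>L. q ^ (i ^ 2) * burge_product L i a b * g (L + a - i)) =
    q ^ (b ^ 2) * (\<Sum>k\<le>L + a + b. q ^ ((L + a - b - k) * (L + a + b - k)) *
      gb (L + a - b) k * gb (L + b - a) (L + a + b - k) * g k)"
proof -
  have *: "(\<Sum>k\<le>L + a + b. q ^ ((L + a - b - k) * (L + a + b - k)) *
      gb (L + a - b) k * gb (L + b - a) (L + a + b - k) * g k) =
     (\<Sum>k\<in>{2 * a..L + a - b}. q ^ ((L + a - b - k) * (L + a + b - k)) *
      gb (L + a - b) k * gb (L + b - a) (L + a + b - k) * g k)"
    by (rule sum.mono_neutral_right) (use ab in \<open>auto simp: not_le\<close>)
  have "q ^ (b ^ 2) * \<dots> = (\<Sum>i\<in>{b..L - a}. q ^ (i ^ 2) * burge_product L i a b * g (L + a - i))"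
    unfolding sum_distrib_left
  proof (rule sum.reindex_bij_witness[of _ "\<lambda>i. L + a - i" "\<lambda>k. L + a - k"], goal_cases)
    case (5 k)
    define i where "i = L + a - k"
    have i: "b \<le> i" "a + i \<le> L" and k: "k = L + a - i"
      using 5 ab by (auto simp: i_def)
    have e: "b ^ 2 + (i - b) * (i + b) = i ^ 2"
      using i by (auto simp: power2_eq_square nat_le_iff_add algebra_simps)
    have "L + a - b - k = i - b" "L + a + b - k = i + b"
      using i ab by (auto simp: k)
    moreover have "gb (L + a - b) (i - b) = gb (L + a - b) k"
      using gbinom_nat_sym[of "i - b" "L + a - b" q] i by (simp add: k)
    ultimately show ?case
      using i unfolding i_def[symmetric]
      by (simp add: burge_product_def k power_add mult_ac add.commute[of i b] flip: e)
  qed (use ab in auto)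
  also have "\<dots> = (\<Sum>i\<le>L. q ^ (i ^ 2) * burge_product L i a b * g (L + a - i))"
    by (rule sum.mono_neutral_left) (auto simp: burge_product_def)
  finally show ?thesis unfolding * ..
qed

lemma burge_product_eq_0: "L < a + b \<Longrightarrow> burge_product L i a b = 0"
  by (auto simp: burge_product_def)

text \<open>If \<open>a + b > L\<close>, both sides are zero. Otherwise \<open>q_nanjundiah\<close>
  applies with \<open>A = L + a - b\<close>, \<open>B = L + b - a\<close>, lower entry
  \<open>L + a + b\<close>, and the \<open>m\<close> and \<open>u\<close> defined below.\<close>

lemma burge_transform:
  assumes "L \<le> n"
  shows "(\<Sum>i\<le>L. q ^ (i ^ 2) * gb (n + L - i) (2 * L) * burge_product L i a b) =
    q ^ (b ^ 2) * burge_product n L b (a + b)"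
proof (cases "a + b \<le> L")
  case True
  define m u where "m = L - a - b" and "u = n - L + b"
  have m: "m + u = n - a" "L + a - b + u = n + a" "m + (L + a + b) = 2 * L"
    "(L + a - b) + (L + b - a) = m + (L + a + b)"
    using True assms by (auto simp: m_def u_def)
  have "(\<Sum>i\<le>L. q ^ (i ^ 2) * gb (n + L - i) (2 * L) * burge_product L i a b) =
    (\<Sum>i\<le>L. q ^ (i ^ 2) * burge_product L i a b * gb (m + u + (L + a - i)) (m + (L + a + b)))"
  proof (intro sum.cong refl)
    fix i assume "i \<in> {..L}"
    then have "n - a + (L + a - i) = n + L - i"
      using True assms by auto
    then show "q ^ (i ^ 2) * gb (n + L - i) (2 * L) * burge_product L i a b =
      q ^ (i ^ 2) * burge_product L i a b * gb (m + u + (L + a - i)) (m + (L + a + b))"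
      unfolding m by simp
  qed
  also have "\<dots> = q ^ (b ^ 2) * (gb (m + u) m * gb (L + a - b + u) (L + a + b))"
    unfolding sum_burge_product[OF True, where g = "\<lambda>k. gb (m + u + k) (m + (L + a + b))"] q_nanjundiah[OF m(4)] ..
  also have "gb (m + u) m * gb (L + a - b + u) (L + a + b) = burge_product n L b (a + b)"
    using True assms unfolding m by (auto simp: burge_product_def m_def ac_simps)
  finally show ?thesis .
next
  case False
  then have "burge_product n L b (a + b) = 0"
    by (simp add: burge_product_def)
  with False show ?thesis by (simp add: burge_product_eq_0)
qed

text \<open>The limit of \<open>burge_transform\<close> as \<open>n\<close> grows, multiplied by
  \<open>qp (2 * L)\<close>; with \<open>g = 1\<close> it is plain \<open>q_vandermonde\<close>. It
  serves the sum over the second index, where a q-factorial replaces the binomial.\<close>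

lemma burge_transform_limit:
  "(\<Sum>i\<le>L. q ^ (i ^ 2) * burge_product L i a b) = q ^ (b ^ 2) * gb (2 * L) (L + (a + b))"
proof (cases "a + b \<le> L")
  case True
  then have "(L + a - b) + (L + b - a) = 2 * L" by simp
  then show ?thesis
    using sum_burge_product[OF True, of "\<lambda>_. 1"] q_vandermonde[of "L + a - b" "L + b - a" "L + a + b"]
    by (simp add: add.assoc)
next
  case False
  then show ?thesis by (simp add: burge_product_eq_0)
qed

section \<open>Fibonacci iteration of the Burge transform\<close>

text \<open>Induction on \<open>d\<close>: \<open>gb_theta_expansion\<close> is the start, and each
  Burge transform adds the square of the current second parameter to the exponent. The bound
  \<open>N\<close> is free so that all inner sums share one range of \<open>t\<close>; terms with
  \<open>t > l\<close> vanish by the guard in \<open>burge_product\<close>.\<close>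

lemma nested_sum_eq:
  "l \<le> n \<Longrightarrow> l \<le> N \<Longrightarrow> nested_sum q d n l =
     (\<Sum>t\<le>N. theta_coeff q 1 t * q ^ (t ^ 2 * (fib (d + 1) * fib (d + 2))) *
        burge_product n l (fib (d + 1) * t) (fib (d + 2) * t))"
proof (induction d arbitrary: n l N)
  case 0
  have "gb n l = (\<Sum>t\<le>l. theta_coeff q 1 t * q ^ (t ^ 2) * burge_product n l t t)"
    unfolding gb_theta_expansion[OF 0(1)]
    by (intro sum.cong refl) (auto simp: burge_product_def)
  also have "\<dots> = (\<Sum>t\<le>N. theta_coeff q 1 t * q ^ (t ^ 2) * burge_product n l t t)"
    by (rule sum.mono_neutral_left) (use 0 in \<open>auto simp: burge_product_def\<close>)
  finally show ?case by (simp add: numeral_2_eq_2)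
next
  case (Suc d)
  define a b where "a = fib (d + 1)" and "b = fib (d + 2)"
  have fib: "fib (d + 3) = a + b"
    by (simp add: a_def b_def numeral_eq_Suc)
  have index: "Suc d + 1 = d + 2" "Suc d + 2 = d + 3" by simp_all
  have "nested_sum q (Suc d) n l =
     (\<Sum>i\<le>l. q ^ (i ^ 2) * gb (n + l - i) (2 * l) *
        (\<Sum>t\<le>N. theta_coeff q 1 t * q ^ (t ^ 2 * (a * b)) * burge_product l i (a * t) (b * t)))"
    unfolding nested_sum.simps a_def b_def
    by (intro sum.cong refl, subst Suc.IH[where N = N])
       (use Suc.prems in \<open>simp_all add: qbinom_nat_diff\<close>)
  also have "\<dots> = (\<Sum>t\<le>N. theta_coeff q 1 t * q ^ (t ^ 2 * (a * b)) *
      (\<Sum>i\<le>l. q ^ (i ^ 2) * gb (n + l - i) (2 * l) * burge_product l i (a * t) (b * t)))"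
    unfolding sum_distrib_left by (subst sum.swap) (simp add: mult_ac)
  also have "\<dots> = (\<Sum>t\<le>N. theta_coeff q 1 t * q ^ (t ^ 2 * (b * (a + b))) *
        burge_product n l (b * t) ((a + b) * t))"
    unfolding burge_transform[OF Suc.prems(1)]
    by (intro sum.cong refl) (simp add: power_add power_mult_distrib algebra_simps power2_eq_square)
  finally show ?case
    unfolding index fib b_def .
qed

lemma sum_nested_sum:
  assumes "L \<le> N"
  shows "(\<Sum>i\<le>L. q ^ (i ^ 2) * nested_sum q d L i) =
     (\<Sum>t\<le>N. theta_coeff q 1 t * q ^ (t ^ 2 * (fib (d + 2) * fib (d + 3))) *
        gb (2 * L) (L + fib (d + 3) * t))"
proof -
  define a b where "a = fib (d + 1)" and "b = fib (d + 2)"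
  have fib: "fib (d + 3) = a + b"
    by (simp add: a_def b_def numeral_eq_Suc)
  have "(\<Sum>i\<le>L. q ^ (i ^ 2) * nested_sum q d L i) =
     (\<Sum>i\<le>L. q ^ (i ^ 2) *
        (\<Sum>t\<le>N. theta_coeff q 1 t * q ^ (t ^ 2 * (a * b)) * burge_product L i (a * t) (b * t)))"
    unfolding a_def b_def
    by (intro sum.cong refl, subst nested_sum_eq[where N = N]) (use assms in simp_all)
  also have "\<dots> = (\<Sum>t\<le>N. theta_coeff q 1 t * q ^ (t ^ 2 * (a * b)) *
      (\<Sum>i\<le>L. q ^ (i ^ 2) * burge_product L i (a * t) (b * t)))"
    unfolding sum_distrib_left by (subst sum.swap) (simp add: mult_ac)
  also have "\<dots> = (\<Sum>t\<le>N. theta_coeff q 1 t * q ^ (t ^ 2 * (b * (a + b))) *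
        gb (2 * L) (L + (a + b) * t))"
    unfolding burge_transform_limit
    by (intro sum.cong refl) (simp add: power_add power_mult_distrib algebra_simps power2_eq_square)
  finally show ?thesis unfolding fib b_def .
qed

text \<open>\<open>bailey_sum\<close> with both cut-offs equal to \<open>M\<close>, applied to each
  term of \<open>sum_nested_sum\<close>. It carries the Fibonacci exponent one last step, by
  \<open>(fib (d + 3) * t) ^ 2\<close>.\<close>

lemma finite_theta_identity:
  "(\<Sum>L\<le>M. q ^ (L ^ 2) / qp (2 * L) * (\<Sum>i\<le>L. q ^ (i ^ 2) * nested_sum q d L i) / (qp (M - L)) ^ 2) =
   (\<Sum>t\<le>M. theta_coeff q 1 t * q ^ (t ^ 2 * (fib (d + 3) * fib (d + 4))) *
      (gb (2 * M) (M + fib (d + 3) * t) ^ 2 / qp (2 * M)))"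
proof -
  define b c where "b = fib (d + 2)" and "c = fib (d + 3)"
  have fib: "fib (d + 4) = b + c"
    by (simp add: c_def b_def numeral_eq_Suc)
  define w where "w = (\<lambda>L. q ^ (L ^ 2) / (qp (M - L) * qp (M - L) * qp (2 * L)))"
  have "(\<Sum>L\<le>M. q ^ (L ^ 2) / qp (2 * L) * (\<Sum>i\<le>L. q ^ (i ^ 2) * nested_sum q d L i) / (qp (M - L)) ^ 2) =
     (\<Sum>L\<le>M. w L * (\<Sum>t\<le>M. theta_coeff q 1 t * q ^ (t ^ 2 * (b * c)) * gb (2 * L) (L + c * t)))"
    unfolding w_def b_def c_def
    by (intro sum.cong refl, subst sum_nested_sum[where N = M]) (simp_all add: power2_eq_square mult_ac)
  also have "\<dots> = (\<Sum>t\<le>M. theta_coeff q 1 t * q ^ (t ^ 2 * (b * c)) *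
      (\<Sum>L\<le>min M M. w L * gb (2 * L) (L + c * t)))"
    unfolding sum_distrib_left by (subst sum.swap) (simp add: mult_ac)
  also have "\<dots> = (\<Sum>t\<le>M. theta_coeff q 1 t * q ^ (t ^ 2 * (c * (b + c))) *
      (gb (2 * M) (M + c * t) ^ 2 / qp (2 * M)))"
    unfolding w_def bailey_sum unfolding mult_2
    by (intro sum.cong refl) (simp add: power_add power_mult_distrib algebra_simps power2_eq_square)
  finally show ?thesis unfolding fib c_def .
qed

end

subsection \<open>Passage to the limit\<close>

text \<open>Tannery's theorem, with dominating series \<open>norm (a t) * C\<close>.\<close>

lemma tendsto_weighted_partial_sums:
  fixes a :: "nat \<Rightarrow> complex"
  assumes "summable (\<lambda>t. norm (a t))"
    and bound: "\<And>M t. norm (g M t) \<le> C"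
    and lim: "\<And>t. (\<lambda>M. g M t) \<longlonglongrightarrow> c"
  shows "(\<lambda>M. \<Sum>t\<le>M. a t * g M t) \<longlonglongrightarrow> suminf a * c"
proof -
  \<comment> \<open>Extension by zero beyond the cut-off turns the finite sums into series over all
    \<open>t\<close>.\<close>
  define h where "h = (\<lambda>t M. if t \<le> M then a t * g M t else 0)"
  have C: "C \<ge> 0"
    using bound[of 0 0] norm_ge_zero order_trans by blast
  have "(\<lambda>M. \<Sum>t. h t M) \<longlonglongrightarrow> (\<Sum>t. a t * c)"
  proof (rule tannerys_theorem[THEN conjunct2, THEN conjunct2])
    fix t
    have "(\<lambda>M. a t * g M t) \<longlonglongrightarrow> a t * c"
      by (intro tendsto_intros lim)
    then show "(\<lambda>M. h t M) \<longlonglongrightarrow> a t * c"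
      by (rule Lim_transform_eventually)
         (auto simp: h_def eventually_at_top_linorder intro!: exI[of _ t])
  next
    have "norm (h t M) \<le> norm (a t) * C" for t M
      using bound[of M t] C by (auto simp: h_def norm_mult mult_left_mono)
    then show "\<forall>\<^sub>F (t, M) in at_top \<times>\<^sub>F sequentially. norm (h t M) \<le> norm (a t) * C"
      by (intro always_eventually) auto
    show "summable (\<lambda>t. norm (a t) * C)"
      by (intro summable_mult2 assms)
  qed simp
  also have "(\<lambda>M. \<Sum>t. h t M) = (\<lambda>M. \<Sum>t\<le>M. a t * g M t)"
  proof
    fix M
    have "(\<Sum>t. h t M) = (\<Sum>t\<le>M. h t M)"
      by (rule suminf_finite) (auto simp: h_def)
    then show "(\<Sum>t. h t M) = (\<Sum>t\<le>M. a t * g M t)"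
      by (simp add: h_def)
  qed
  also have "(\<Sum>t. a t * c) = suminf a * c"
    by (rule suminf_mult2[symmetric]) (rule summable_norm_cancel[OF assms(1)])
  finally show ?thesis .
qed

section \<open>Unconditional sums over tuples of naturals\<close>

definition supported_upto :: "nat \<Rightarrow> (nat \<Rightarrow> nat) set" where
  "supported_upto n = {m. \<forall>i. i \<notin> {1..n} \<longrightarrow> m i = 0}"

lemma bij_betw_supported_upto_Suc:
  "bij_betw (\<lambda>(m, x). m(Suc n := x)) (supported_upto n \<times> UNIV) (supported_upto (Suc n))"
proof (rule bij_betw_byWitness[where f' = "\<lambda>m. (m(Suc n := 0), m (Suc n))"])
  show "\<forall>a\<in>supported_upto n \<times> UNIV.
     (\<lambda>m. (m(Suc n := 0), m (Suc n))) ((\<lambda>(m, x). m(Suc n := x)) a) = a"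
    by (auto simp: supported_upto_def fun_eq_iff)
qed (auto simp: supported_upto_def)

text \<open>Fubini's theorem with the last coordinate summed first; convergence of the outer sum is
  inherited from the full sum.\<close>

lemma has_sum_supported_upto_Suc:
  fixes f :: "(nat \<Rightarrow> nat) \<Rightarrow> complex"
  assumes "(f has_sum S) (supported_upto (Suc n))"
    and "\<And>m. m \<in> supported_upto n \<Longrightarrow> ((\<lambda>x. f (m(Suc n := x))) has_sum g m) UNIV"
  shows "(g has_sum S) (supported_upto n)"
proof (rule has_sum_SigmaD)
  show "((\<lambda>z. f (case z of (m, x) \<Rightarrow> m(Suc n := x))) has_sum S) (supported_upto n \<times> UNIV)"
    using assms(1) by (subst has_sum_reindex_bij_betw[OF bij_betw_supported_upto_Suc])
qed (use assms(2) in auto)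

text \<open>Supplies the majorant of the multiple series: by nonnegativity, coordinates can be
  adjoined one at a time, each contributing the factor \<open>infsum f UNIV\<close>.\<close>

lemma summable_on_prod_supported_upto:
  fixes f :: "nat \<Rightarrow> real"
  assumes f: "f summable_on UNIV" and nonneg: "\<And>x. f x \<ge> 0"
  shows "(\<lambda>m. \<Prod>j=1..n. f (m j)) summable_on supported_upto n"
proof (induction n)
  case 0
  have "supported_upto 0 = {\<lambda>_. 0}"
    by (auto simp: supported_upto_def)
  then show ?case by simp
next
  case (Suc n)
  have "(\<lambda>(m, x). (\<Prod>j=1..n. f (m j)) * f x) summable_on (supported_upto n \<times> UNIV)"
  proof (rule summable_on_SigmaI)
    fix m
    show "((\<lambda>x. (case (m, x) of (m, x) \<Rightarrow> (\<Prod>j=1..n. f (m j)) * f x))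
        has_sum (\<Prod>j=1..n. f (m j)) * infsum f UNIV) UNIV"
      unfolding prod.case by (intro has_sum_cmult_right has_sum_infsum f)
    show "(\<lambda>m. (\<Prod>j=1..n. f (m j)) * infsum f UNIV) summable_on supported_upto n"
      by (intro summable_on_cmult_left Suc)
  qed (auto intro!: mult_nonneg_nonneg prod_nonneg nonneg)
  also have "(\<lambda>(m, x). (\<Prod>j=1..n. f (m j)) * f x) =
      (\<lambda>z. \<Prod>j=1..Suc n. f ((case z of (m, x) \<Rightarrow> m(Suc n := x)) j))"
    by (auto simp: fun_eq_iff)
  also have "\<dots> summable_on (supported_upto n \<times> UNIV) \<longleftrightarrow>
      (\<lambda>m. \<Prod>j=1..Suc n. f (m j)) summable_on supported_upto (Suc n)"
    by (rule summable_on_reindex_bij_betw[OF bij_betw_supported_upto_Suc])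
  finally show ?case .
qed

section \<open>Infinite q-products, theta series and the cut-off limit\<close>

context unit_disc
begin

lemma qpoch_convergent: "convergent_prod (\<lambda>i. 1 - x * q ^ i)"
proof -
  have "summable (\<lambda>i. norm (1 - x * q ^ i - 1))"
    using norm_q by (auto simp: norm_mult norm_power intro!: summable_mult summable_geometric)
  then show ?thesis
    by (intro abs_convergent_prod_imp_convergent_prod summable_imp_abs_convergent_prod)
qed

lemma qpoch_tendsto: "qpoch x q \<longlonglongrightarrow> qpoch_inf x q"
  using convergent_prod_LIMSEQ[OF qpoch_convergent[of x]]
  unfolding qpoch_def[abs_def] qpoch_inf_def LIMSEQ_lessThan_iff_atMost .

abbreviation qp_inf where "qp_inf \<equiv> qpoch_inf q q"

lemma qp_inf_nonzero [simp]: "qp_inf \<noteq> 0"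
  unfolding qpoch_inf_def
  by (rule prodinf_nonzero[OF qpoch_convergent])
     (use one_minus_power_nonzero[of "Suc _"] in auto)

lemma qp_bounds: obtains C where "C \<ge> 1" "\<And>n. norm (qp n) \<le> C" "\<And>n. norm (1 / qp n) \<le> C"
proof -
  have "(\<lambda>n. 1 / qp n) \<longlonglongrightarrow> 1 / qp_inf"
    by (intro tendsto_intros qpoch_tendsto qp_inf_nonzero)
  then have "Bseq (\<lambda>n. 1 / qp n)"
    by (intro convergent_imp_Bseq convergentI)
  moreover have "Bseq qp"
    by (rule convergent_imp_Bseq, rule convergentI, rule qpoch_tendsto)
  ultimately obtain A B where "\<And>n. norm (1 / qp n) \<le> A" "\<And>n. norm (qp n) \<le> B"
    unfolding Bseq_def by blast
  then show ?thesis
    by (intro that[of "max 1 (max A B)"]) (auto simp: le_max_iff_disj)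
qed

lemma gb_bounded: obtains C where "C \<ge> 1" "\<And>n k. norm (gb n k) \<le> C"
proof -
  obtain D where D: "D \<ge> 1" "\<And>n. norm (qp n) \<le> D" "\<And>n. norm (1 / qp n) \<le> D"
    using qp_bounds by blast
  have "norm (gb n k) \<le> D * D * D" for n k
  proof (cases "k \<le> n")
    case True
    then have "gb n k = qp n * (1 / qp k) * (1 / qp (n - k))"
      by (simp add: gbinom_nat_eq)
    also have "norm \<dots> \<le> D * D * D"
      unfolding norm_mult by (intro mult_mono D mult_nonneg_nonneg) (use D(1) in auto)
    finally show ?thesis .
  qed (use D(1) in auto)
  moreover have "D * D * D \<ge> 1"
    using D(1) by (metis mult_mono' mult_1 zero_le_one)
  ultimately show ?thesis using that by blast
qed

lemma gb_central_tendsto: "(\<lambda>n. gb (2 * n) (n + t)) \<longlonglongrightarrow> 1 / qp_inf"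
proof -
  have f: "filterlim (\<lambda>n. 2 * n) sequentially sequentially"
    "filterlim (\<lambda>n. n + t) sequentially sequentially"
    "filterlim (\<lambda>n. n - t) sequentially sequentially"
    by (auto intro: filterlim_subseq simp: strict_mono_def filterlim_add_const_nat_at_top filterlim_minus_const_nat_at_top)
  have "(\<lambda>n. qp (2 * n) / (qp (n + t) * qp (n - t))) \<longlonglongrightarrow> qp_inf / (qp_inf * qp_inf)"
    by (intro tendsto_intros filterlim_compose[OF qpoch_tendsto] f) auto
  also have "qp_inf / (qp_inf * qp_inf) = 1 / qp_inf"
    by simp
  finally show ?thesis
    by (rule Lim_transform_eventually)
       (auto simp: gbinom_nat_eq mult_2 eventually_at_top_linorder intro!: exI[of _ t])
qed

text \<open>Two evaluations of the limit of \<open>finite_jacobi_triple_product\<close>: factor by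
  factor on the product side, and by Tannery's theorem on the series side.\<close>

lemma jacobi_triple_product:
  assumes "x * y = q" and "summable (\<lambda>t. norm (theta_coeff x y t))"
  shows "qpoch_inf x q * qpoch_inf y q * qp_inf = suminf (theta_coeff x y)"
proof -
  obtain C where "\<And>n k. norm (gb n k) \<le> C"
    using gb_bounded by blast
  then have "(\<lambda>M. \<Sum>t\<le>M. theta_coeff x y t * gb (2 * M) (M + t))
      \<longlonglongrightarrow> suminf (theta_coeff x y) * (1 / qp_inf)"
    by (intro tendsto_weighted_partial_sums assms gb_central_tendsto)
  moreover have "(\<lambda>M. \<Sum>t\<le>M. theta_coeff x y t * gb (2 * M) (M + t))
      \<longlonglongrightarrow> qpoch_inf x q * qpoch_inf y q"
    unfolding finite_jacobi_triple_product[OF assms(1), symmetric]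
    by (intro tendsto_intros qpoch_tendsto)
  ultimately show ?thesis
    using LIMSEQ_unique by (fastforce simp: field_simps)
qed

text \<open>The quadratic weight is absorbed by changing the base from \<open>q\<close> to
  \<open>q ^ (2 * N + 1)\<close>, because \<open>2 * (t choose 2) + t\<close> is
  \<open>t * t\<close>. Thus the weighted series is again a triple product series.\<close>

lemma theta_coeff_power:
  "theta_coeff (q ^ (N + 1)) (q ^ N) t = theta_coeff q 1 t * q ^ (t ^ 2 * N)"
proof (cases "t = 0")
  case False
  have "t * N + (2 * N + 1) * (t choose 2) = (t choose 2) + (2 * (t choose 2) + t) * N"
    by (simp add: algebra_simps)
  then have "t * N + (2 * N + 1) * (t choose 2) = (t choose 2) + t ^ 2 * N"
    unfolding twice_choose_two by (simp add: power2_eq_square)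
  then have 1: "q ^ (t * N) * (q ^ (2 * N + 1)) ^ (t choose 2) = q ^ (t choose 2) * q ^ (t ^ 2 * N)"
    by (simp only: flip: power_add power_mult)
  have 2: "q ^ (N + 1) * q ^ N = q ^ (2 * N + 1)"
    by (simp add: mult_2 power_add)
  have 3: "(q ^ (N + 1)) ^ t + (q ^ N) ^ t = (q ^ t + 1) * q ^ (t * N)"
    by (simp add: power_mult_distrib algebra_simps flip: power_mult)
  have "theta_coeff (q ^ (N + 1)) (q ^ N) t =
      (-1) ^ t * (q ^ t + 1) * (q ^ (t * N) * (q ^ (2 * N + 1)) ^ (t choose 2))"
    using False unfolding theta_coeff_def 2 3 by simp
  also have "\<dots> = theta_coeff q 1 t * q ^ (t ^ 2 * N)"
    using False unfolding 1 by (simp add: theta_coeff_def)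
  finally show ?thesis .
qed (simp add: theta_coeff_def)

lemma summable_theta_coeff:
  assumes "N \<ge> 1"
  shows "summable (\<lambda>t. norm (theta_coeff q 1 t * q ^ (t ^ 2 * N)))"
proof (rule summable_comparison_test')
  show "summable (\<lambda>t. 2 * norm q ^ t)"
    using norm_q by (intro summable_mult summable_geometric) simp
  fix t :: nat
  have p: "norm q ^ n \<le> 1" for n
    using norm_q by (simp add: power_le_one)
  have "norm (q ^ t + 1) \<le> 1 + 1"
    by (rule order_trans[OF norm_triangle_ineq]) (use p[of t] in \<open>simp add: norm_power\<close>)
  then have "norm (q ^ t + 1) * norm q ^ (t choose 2) \<le> 2 * 1"
    by (intro mult_mono p) auto
  then have 1: "norm (theta_coeff q 1 t) \<le> 2"
    by (auto simp: theta_coeff_def norm_mult norm_power)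
  have "t * 1 \<le> t * (t * N)"
    using assms by (cases "t = 0") (auto simp: Suc_le_eq)
  then have "t \<le> t ^ 2 * N"
    by (simp add: power2_eq_square mult.assoc)
  then have 2: "norm q ^ (t ^ 2 * N) \<le> norm q ^ t"
    using norm_q by (intro power_decreasing) auto
  show "norm (norm (theta_coeff q 1 t * q ^ (t ^ 2 * N))) \<le> 2 * norm q ^ t"
    unfolding norm_mult norm_power real_norm_def abs_mult power_abs abs_norm_cancel
    by (intro mult_mono 1 2) auto
qed

text \<open>Let \<open>M\<close> tend to infinity in \<open>finite_theta_identity\<close>. The left
  side gains \<open>1 / qp_inf ^ 2\<close>; the right side gains \<open>1 / qp_inf ^ 3\<close>, two
  factors from the squared binomial and one from \<open>1 / qp (2 * M)\<close>.\<close>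

lemma nested_series_sum:
  fixes d :: nat
  defines "N \<equiv> fib (d + 3) * fib (d + 4)"
  defines "u \<equiv> \<lambda>L. q ^ (L ^ 2) / qp (2 * L) * (\<Sum>i\<le>L. q ^ (i ^ 2) * nested_sum q d L i)"
  assumes "summable (\<lambda>L. norm (u L))"
  shows "suminf u = (\<Sum>t. theta_coeff q 1 t * q ^ (t ^ 2 * N)) / qp_inf"
proof -
  obtain C where C: "C \<ge> 1" "\<And>n. norm (qp n) \<le> C" "\<And>n. norm (1 / qp n) \<le> C"
    using qp_bounds by blast
  obtain G where G: "G \<ge> 1" "\<And>n k. norm (gb n k) \<le> G"
    using gb_bounded by blast
  have N: "N \<ge> 1" by (simp add: N_def Suc_le_eq fib_neq_0_nat)
  have "(\<lambda>M. \<Sum>L\<le>M. u L * (1 / qp (M - L)) ^ 2) \<longlonglongrightarrow> suminf u * (1 / qp_inf) ^ 2"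
  proof (rule tendsto_weighted_partial_sums[OF assms(3)])
    show "norm ((1 / qp (M - L)) ^ 2) \<le> C ^ 2" for M L
      unfolding norm_power by (intro power_mono C) auto
    show "(\<lambda>M. (1 / qp (M - L)) ^ 2) \<longlonglongrightarrow> (1 / qp_inf) ^ 2" for L
      by (intro tendsto_intros filterlim_compose[OF qpoch_tendsto] filterlim_minus_const_nat_at_top) auto
  qed
  then have 1: "(\<lambda>M. \<Sum>L\<le>M. u L / (qp (M - L)) ^ 2) \<longlonglongrightarrow> suminf u / qp_inf ^ 2"
    by (simp add: power_one_over)
  have "(\<lambda>M. \<Sum>t\<le>M. theta_coeff q 1 t * q ^ (t ^ 2 * N) *
        (gb (2 * M) (M + fib (d + 3) * t) ^ 2 * (1 / qp (2 * M))))
      \<longlonglongrightarrow> (\<Sum>t. theta_coeff q 1 t * q ^ (t ^ 2 * N)) * ((1 / qp_inf) ^ 2 * (1 / qp_inf))"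
  proof (rule tendsto_weighted_partial_sums[OF summable_theta_coeff[OF N]])
    show "norm (gb (2 * M) (M + fib (d + 3) * t) ^ 2 * (1 / qp (2 * M))) \<le> G ^ 2 * C" for M t
      unfolding norm_mult norm_power by (intro mult_mono power_mono C G) (use C G in auto)
    have "filterlim (\<lambda>n::nat. 2 * n) sequentially sequentially"
      by (auto intro: filterlim_subseq simp: strict_mono_def)
    then show "(\<lambda>M. gb (2 * M) (M + fib (d + 3) * t) ^ 2 * (1 / qp (2 * M)))
        \<longlonglongrightarrow> (1 / qp_inf) ^ 2 * (1 / qp_inf)" for t
      by (intro tendsto_intros gb_central_tendsto filterlim_compose[OF qpoch_tendsto]) auto
  qed
  then have "(\<lambda>M. \<Sum>L\<le>M. u L / (qp (M - L)) ^ 2)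
      \<longlonglongrightarrow> (\<Sum>t. theta_coeff q 1 t * q ^ (t ^ 2 * N)) / (qp_inf ^ 2 * qp_inf)"
    unfolding u_def finite_theta_identity N_def by (simp add: power_one_over)
  from LIMSEQ_unique[OF 1 this] show ?thesis
    by (simp add: field_simps)
qed

section \<open>Reduction of the multiple sum to a single series\<close>

text \<open>The summand after the \<open>d\<close> innermost of \<open>n + d\<close> summations have been carried out.\<close>

definition multisum_term :: "nat \<Rightarrow> nat \<Rightarrow> (nat \<Rightarrow> nat) \<Rightarrow> complex" where
  "multisum_term n d m =
     q ^ (\<Sum>j=1..n. (m j) ^ 2) / qp (2 * m 1)
     * (\<Prod>j=2..n-1. qbinom q (int (m (j-1)) + int (m j) - int (m (j+1))) (2 * int (m j)))
     * nested_sum q d (m (n-1)) (m n)"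

lemma qbinom_bounded: obtains C where "C \<ge> 1" "\<And>n k. norm (qbinom q n k) \<le> C"
proof -
  obtain C where C: "C \<ge> 1" "\<And>n k. norm (gb n k) \<le> C"
    using gb_bounded by blast
  have "norm (qbinom q n k) \<le> C" for n k
  proof (cases "0 \<le> k \<and> k \<le> n")
    case True
    then have "qbinom q n k = gb (nat n) (nat k)"
      by (simp add: gbinom_nat_def)
    with C show ?thesis by simp
  qed (use C in \<open>auto simp: qbinom_def\<close>)
  with C(1) show ?thesis using that by blast
qed

text \<open>All q-binomials and reciprocal q-factorials are bounded uniformly, so the summand is
  dominated by a constant times the product of the \<open>norm q ^ ((m j) ^ 2)\<close>.\<close>

lemma multisum_term_summable: "multisum_term n 0 summable_on supported_upto n"
proof -
  obtain C where C: "C \<ge> 1" "\<And>n. norm (qp n) \<le> C" "\<And>n. norm (1 / qp n) \<le> C"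
    using qp_bounds by blast
  obtain G where G: "G \<ge> 1" "\<And>n k. norm (qbinom q n k) \<le> G"
    using qbinom_bounded by blast
  define D where "D = C * G ^ card {2..n-1} * G"
  have "(\<lambda>x::nat. norm q ^ (x ^ 2)) summable_on UNIV"
  proof (rule summable_nonneg_imp_summable_on)
    show "summable (\<lambda>x::nat. norm q ^ (x ^ 2))"
    proof (rule summable_comparison_test')
      show "summable (\<lambda>x. norm q ^ x)"
        using norm_q by (intro summable_geometric) simp
      show "norm (norm q ^ (x ^ 2)) \<le> norm q ^ x" for x :: nat
        using norm_q by (auto intro!: power_decreasing simp: power2_eq_square)
    qed
  qed simp
  then have "(\<lambda>m. \<Prod>j=1..n. norm q ^ ((m j) ^ 2)) summable_on supported_upto n"
    by (rule summable_on_prod_supported_upto) simp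
  then have "(\<lambda>m. (\<Prod>j=1..n. norm q ^ ((m j) ^ 2)) * D) summable_on supported_upto n"
    by (rule summable_on_cmult_left)
  then have "(\<lambda>m. norm (multisum_term n 0 m)) summable_on supported_upto n"
  proof (rule summable_on_comparison_test)
    fix m :: "nat \<Rightarrow> nat"
    define P where "P = (\<Prod>j=2..n-1. qbinom q (int (m (j-1)) + int (m j) - int (m (j+1))) (2 * int (m j)))"
    have "norm P \<le> (\<Prod>j=2..n-1. G)"
      unfolding P_def prod_norm[symmetric] by (rule prod_mono) (simp add: G)
    then have P: "norm P \<le> G ^ card {2..n-1}" by simp
    have "multisum_term n 0 m =
        q ^ (\<Sum>j=1..n. (m j) ^ 2) * ((1 / qp (2 * m 1)) * P * qbinom q (int (m (n-1))) (int (m n)))"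
      by (simp add: multisum_term_def P_def gbinom_nat_def)
    also have "norm \<dots> = norm (q ^ (\<Sum>j=1..n. (m j) ^ 2)) *
        norm ((1 / qp (2 * m 1)) * P * qbinom q (int (m (n-1))) (int (m n)))"
      by (rule norm_mult)
    also have "norm (q ^ (\<Sum>j=1..n. (m j) ^ 2)) = (\<Prod>j=1..n. norm q ^ ((m j) ^ 2))"
      by (simp add: norm_power power_sum flip: prod_norm)
    also have "norm ((1 / qp (2 * m 1)) * P * qbinom q (int (m (n-1))) (int (m n))) \<le> D"
      unfolding norm_mult D_def by (intro mult_mono C G P) (use C(1) G(1) in auto)
    finally show "norm (multisum_term n 0 m) \<le> (\<Prod>j=1..n. norm q ^ ((m j) ^ 2)) * D"
      by (simp add: mult_left_mono prod_nonneg)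
  qed simp
  then show ?thesis
    unfolding summable_on_iff_abs_summable_on_complex .
qed

text \<open>Carries out the summation over the coordinate \<open>Suc n\<close>. For
  \<open>n >= 2\<close> this coordinate enters exactly one q-binomial of the product, the factor
  \<open>j = n\<close>, which becomes the binomial in the recursion of
  \<open>nested_sum\<close>.\<close>

lemma multisum_term_inner:
  assumes "n \<ge> 2"
  shows "((\<lambda>x. multisum_term (Suc n) d (m(Suc n := x))) has_sum multisum_term n (Suc d) m) UNIV"
proof -
  define c where "c = q ^ (\<Sum>j=1..n. (m j) ^ 2) / qp (2 * m 1) *
     (\<Prod>j=2..n-1. qbinom q (int (m (j-1)) + int (m j) - int (m (j+1))) (2 * int (m j)))"
  define h where "h = (\<lambda>x. q ^ (x ^ 2) *
     qbinom q (int (m (n-1)) + int (m n) - int x) (2 * int (m n)) * nested_sum q d (m n) x)"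
  have "multisum_term (Suc n) d (m(Suc n := x)) = c * h x" for x
  proof -
    let ?m = "m(Suc n := x)"
    have "(\<Prod>j=2..n. qbinom q (int (?m (j-1)) + int (?m j) - int (?m (j+1))) (2 * int (?m j))) =
      (\<Prod>j=2..n-1. qbinom q (int (?m (j-1)) + int (?m j) - int (?m (j+1))) (2 * int (?m j))) *
      qbinom q (int (m (n-1)) + int (m n) - int x) (2 * int (m n))"
    proof -
      have *: "prod f {2..n} = prod f {2..n-1} * f n" for f :: "nat \<Rightarrow> complex"
        using assms prod.nat_ivl_Suc'[of 2 "n - 1" f] by (simp add: mult.commute)
      have **: "n - 1 \<noteq> Suc n" by simp
      show ?thesis
        unfolding * by (rule arg_cong2[where f = "(*)", OF refl]) (simp add: ** del: One_nat_def)
    qed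
    also have "(\<Prod>j=2..n-1. qbinom q (int (?m (j-1)) + int (?m j) - int (?m (j+1))) (2 * int (?m j))) =
      (\<Prod>j=2..n-1. qbinom q (int (m (j-1)) + int (m j) - int (m (j+1))) (2 * int (m j)))"
      by (intro prod.cong refl) auto
    finally have 1: "(\<Prod>j=2..n. qbinom q (int (?m (j-1)) + int (?m j) - int (?m (j+1))) (2 * int (?m j))) = \<dots> *
      qbinom q (int (m (n-1)) + int (m n) - int x) (2 * int (m n))" .
    have 2: "(\<Sum>j=1..Suc n. (?m j) ^ 2) = (\<Sum>j=1..n. (m j) ^ 2) + x ^ 2"
      by simp
    show ?thesis
      using assms unfolding multisum_term_def diff_Suc_1 1 2
      by (simp add: c_def h_def power_add mult_ac)
  qed
  \<comment> \<open>The series is finite: \<open>nested_sum q d (m n) x\<close> vanishes for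
    \<open>x > m n\<close>.\<close>
  moreover have "(h has_sum sum h {..m n}) UNIV"
    by (rule has_sum_finite_neutralI) (auto simp: h_def nested_sum_eq_0)
  then have "((\<lambda>x. c * h x) has_sum (c * sum h {..m n})) UNIV"
    by (rule has_sum_cmult_right)
  moreover have "c * sum h {..m n} = multisum_term n (Suc d) m"
    by (simp add: c_def h_def multisum_term_def)
  ultimately show ?thesis by simp
qed

lemma multisum_term_reduce:
  "n \<ge> 2 \<Longrightarrow> (multisum_term (n + d) 0 has_sum S) (supported_upto (n + d)) \<Longrightarrow>
     (multisum_term n d has_sum S) (supported_upto n)"
proof (induction d arbitrary: n)
  case (Suc d)
  have "(multisum_term (Suc n) d has_sum S) (supported_upto (Suc n))"
    by (rule Suc.IH) (use Suc.prems in auto)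
  then show ?case
    by (rule has_sum_supported_upto_Suc) (rule multisum_term_inner[OF Suc.prems(1)])
qed simp

text \<open>Absolute convergence permits iterated summation from the innermost index outwards, which
  ends in the series over the first index evaluated by \<open>nested_series_sum\<close>.\<close>

lemma multisum_has_sum:
  fixes d :: nat
  defines "N \<equiv> fib (d + 3) * fib (d + 4)"
  shows "(multisum_term (d + 2) 0 has_sum
     (\<Sum>t. theta_coeff q 1 t * q ^ (t ^ 2 * N)) / qp_inf) (supported_upto (d + 2))"
proof -
  define S where "S = infsum (multisum_term (d + 2) 0) (supported_upto (d + 2))"
  define u where "u = (\<lambda>L. q ^ (L ^ 2) / qp (2 * L) * (\<Sum>i\<le>L. q ^ (i ^ 2) * nested_sum q d L i))"
  have S: "(multisum_term (d + 2) 0 has_sum S) (supported_upto (d + 2))"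
    unfolding S_def by (rule has_sum_infsum[OF multisum_term_summable])
  then have "(multisum_term 2 d has_sum S) (supported_upto 2)"
    using multisum_term_reduce[of 2 d S] by (simp only: add.commute[of d 2] order.refl)
  \<comment> \<open>The second coordinate is summed separately: the product starts at
    \<open>j = 2\<close>, so no q-binomial has lower entry \<open>2 * m 1\<close>.\<close>
  then have "(multisum_term (Suc 1) d has_sum S) (supported_upto (Suc 1))"
    by (simp add: numeral_2_eq_2)
  then have "((\<lambda>m. u (m 1)) has_sum S) (supported_upto 1)"
  proof (rule has_sum_supported_upto_Suc)
    fix m :: "nat \<Rightarrow> nat"
    define h where "h = (\<lambda>i. q ^ (i ^ 2) * nested_sum q d (m 1) i)"
    have "(h has_sum sum h {..m 1}) UNIV"
      by (rule has_sum_finite_neutralI) (auto simp: h_def nested_sum_eq_0)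
    then have "((\<lambda>x. q ^ ((m 1) ^ 2) / qp (2 * m 1) * h x) has_sum
        (q ^ ((m 1) ^ 2) / qp (2 * m 1) * sum h {..m 1})) UNIV"
      by (rule has_sum_cmult_right)
    then show "((\<lambda>x. multisum_term (Suc 1) d (m(Suc 1 := x))) has_sum u (m 1)) UNIV"
      by (simp add: multisum_term_def u_def h_def power_add mult_ac)
  qed
  also have "((\<lambda>m. u (m 1)) has_sum S) (supported_upto 1) \<longleftrightarrow> (u has_sum S) UNIV"
    by (rule has_sum_reindex_bij_witness[where j = "\<lambda>m. m 1" and i = "\<lambda>x. (\<lambda>_. 0)(1 := x)"])
       (auto simp: supported_upto_def fun_eq_iff)
  finally have u: "(u has_sum S) UNIV" .
  have "u summable_on UNIV"
    using u by (rule has_sum_imp_summable)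
  then have "summable (\<lambda>L. norm (u L))"
    unfolding summable_on_iff_abs_summable_on_complex by (rule summable_on_imp_summable)
  then have "suminf u = (\<Sum>t. theta_coeff q 1 t * q ^ (t ^ 2 * N)) / qp_inf"
    unfolding u_def N_def by (rule nested_series_sum)
  moreover have "suminf u = S"
    using has_sum_imp_sums[OF u] by (rule sums_unique[symmetric])
  ultimately show ?thesis using S by simp
qed

end

theorem theorem1p4:
  fixes q :: complex and k :: nat
  assumes "norm q < 1" and "k \<ge> 4"
  shows "((\<lambda>m::nat \<Rightarrow> nat.
            q ^ (\<Sum>j=1..k-2. (m j)^2) / qpoch q q (2 * m 1)
            * (\<Prod>j=2..k-3. qbinom q (int (m (j-1)) + int (m j) - int (m (j+1))) (2 * int (m j)))
            * qbinom q (int (m (k-3))) (int (m (k-2))))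
         has_sum
           (qpoch_inf (q ^ (fib k * fib (k-1))) (q ^ (2 * fib k * fib (k-1) + 1))
            * qpoch_inf (q ^ (fib k * fib (k-1) + 1)) (q ^ (2 * fib k * fib (k-1) + 1))
            * qpoch_inf (q ^ (2 * fib k * fib (k-1) + 1)) (q ^ (2 * fib k * fib (k-1) + 1))
            / qpoch_inf q q))
         {m. \<forall>i. i \<notin> {1..k-2} \<longrightarrow> m i = 0}"
proof -
  interpret unit_disc q by (rule unit_disc.intro) (rule assms(1))
  \<comment> \<open>Of the \<open>k - 2 = d + 2\<close> indices, the \<open>d\<close> innermost are
    handled by \<open>nested_sum\<close>.\<close>
  obtain d where k: "k = d + 4"
    using assms(2) by (metis add.commute le_Suc_ex)
  have k_minus: "k - 1 = d + 3" "k - 2 = d + 2" "k - 3 = d + 1"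
    by (simp_all add: k)
  have index: "d + 2 - 1 = d + 1" by simp
  define N where "N = fib (d + 3) * fib (d + 4)"
  have N: "N \<ge> 1" by (simp add: N_def Suc_le_eq fib_neq_0_nat)
  have "norm (q ^ (2 * N + 1)) < 1"
    using norm_q by (simp only: norm_power power_less_one_iff norm_ge_zero) simp
  \<comment> \<open>The triple product is applied in base \<open>q ^ (2 * N + 1)\<close>, while
    \<open>qpoch_inf q q\<close> in the denominator keeps the base \<open>q\<close>.\<close>
  then interpret p: unit_disc "q ^ (2 * N + 1)" by (rule unit_disc.intro)
  have theta: "theta_coeff (q ^ (N + 1)) (q ^ N) = (\<lambda>t. theta_coeff q 1 t * q ^ (t ^ 2 * N))"
    by (rule ext) (rule theta_coeff_power)
  have "q ^ (N + 1) * q ^ N = q ^ (2 * N + 1)"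
    by (simp add: mult_2 power_add)
  moreover have "summable (\<lambda>t. norm (theta_coeff (q ^ (N + 1)) (q ^ N) t))"
    unfolding theta by (rule summable_theta_coeff[OF N])
  ultimately have "qpoch_inf (q ^ (N + 1)) (q ^ (2 * N + 1)) * qpoch_inf (q ^ N) (q ^ (2 * N + 1)) *
      qpoch_inf (q ^ (2 * N + 1)) (q ^ (2 * N + 1)) = suminf (theta_coeff (q ^ (N + 1)) (q ^ N))"
    by (rule p.jacobi_triple_product)
  then have "qpoch_inf (q ^ N) (q ^ (2 * N + 1)) * qpoch_inf (q ^ (N + 1)) (q ^ (2 * N + 1)) *
      qpoch_inf (q ^ (2 * N + 1)) (q ^ (2 * N + 1)) / qpoch_inf q q =
      (\<Sum>t. theta_coeff q 1 t * q ^ (t ^ 2 * N)) / qpoch_inf q q"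
    by (simp only: theta mult.commute[of "qpoch_inf (q ^ N) _"])
  moreover have F: "fib k * fib (k - 1) = N"
    unfolding k_minus unfolding N_def k by (rule mult.commute)
  moreover have "2 * fib k * fib (k - 1) = 2 * N"
    unfolding mult.assoc F ..
  ultimately show ?thesis
    using multisum_has_sum[of d]
    by (simp only: k_minus N_def[symmetric] multisum_term_def[abs_def] supported_upto_def
        nested_sum.simps gbinom_nat_def add_diff_cancel_right' index)
qed

end
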